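(* Fix a time slot $t$, a finite set $\mathcal{N}_t^{\mathrm{act}}$ of acting arms with actions $a_{i,t}$ and declarations $(\xi_{i,t},\zeta_{i,t},\alpha_{i,t},\omega_{i,t},\psi_{i,t},\chi_{i,t})$ for $i\in\mathcal{N}_t^{\mathrm{act}}$, and a set $W_t\subseteq\mathcal{X}$ of currently true logical conditions. Let $T_{\xi},T_{\zeta},T_{\alpha},T_{\omega}$ be the mutual-exclusion, synchronization, instantaneous-dependency and persistent-dependency rules, which are maps from subsets of $\mathcal{N}_t^{\mathrm{act}}$ to subsets of $\mathcal{N}_t^{\mathrm{act}}$, and let $\Theta=T_{\xi}\circ T_{\zeta}\circ T_{\alpha}\circ T_{\omega}$. Then $\Theta(\mathcal{A})\subseteq\mathcal{A}$ for every $\mathcal{A}\subseteq\mathcal{N}_t^{\mathrm{act}}$. Consequently the iteration $\mathcal{A}^{(0)}=\mathcal{N}_t^{\mathrm{act}}$, $\mathcal{A}^{(k+1)}=\Theta(\mathcal{A}^{(k)})$ converges in finitely many steps to a unique stable executable set $\mathcal{A}_t^\star$ (that is, there is a unique set $\mathcal{A}_t^\star$ with $\mathcal{A}^{(k)}=\mathcal{A}_t^\star$ for all sufficiently large $k$, and $\Theta(\mathcal{A}_t^\star)=\mathcal{A}_t^\star$), and it is reached in at most $|\mathcal{N}_t^{\mathrm{act}}|$ rounds, i.e. $\mathcal{A}^{(k)}=\mathcal{A}_t^\star$ for all $k\ge|\mathcal{N}_t^{\mathrm{act}}|$.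
   Context: Setting. $\mathcal{N}=\{1,\dots,n\}$ is a finite set of arms (agents), $\mathcal{E}$ a finite set of objects, $\mathcal{P}$ a finite set of resources (placement points), $\mathcal{X}$ a set of logical conditions. Each resource $p\in\mathcal{P}$ has an integer position $\mathrm{pos}(p)\in\mathbb{Z}$, and each object $e\in\mathcal{E}$ has a target resource $p_e^\star\in\mathcal{P}$. At time slot $t$, each arm $i$ has an action $a_{i,t}\in\{a_0\}\cup(\mathcal{E}\times\mathcal{P})$, where $a_0$ means staying still and $(e,p)$ means grasping object $e$ and placing it on resource $p$. The acting set is $\mathcal{N}_t^{\mathrm{act}}=\{i\in\mathcal{N}\mid a_{i,t}\neq a_0\}$. Each acting arm $i$ declares sets $\xi_{i,t}\subseteq\mathcal{E}\cup\mathcal{P}$ (elements it needs to occupy exclusively), $\zeta_{i,t}\subseteq\mathcal{N}$ (members of the group that must act simultaneously with it), $\alpha_{i,t}\subseteq\mathcal{X}$ (prerequisite states that must be produced in the same step), $\omega_{i,t}\subseteq\mathcal{X}$ (states that must be held in the same step), $\psi_{i,t}\subseteq\mathcal{X}$ (states its action instantaneously produces), and $\chi_{i,t}\subseteq\mathcal{X}$ (states its action continuously holds). $W_t\subseteq\mathcal{X}$ is the set of conditions true at time $t$. Priority. For an acting arm $i$ with action $a_{i,t}=(e,p)$, $$\rho(a_{i,t})=\big(\mathbf{1}[p=p_e^\star],\ -|\mathrm{pos}(p)-\mathrm{pos}(p_e^\star)|,\ -\kappa(i)\big)\in\{0,1\}\times\mathbb{Z}_{\le0}\times\mathbb{Z}_{\le0},$$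 where $\kappa(i)$ is the fixed index of arm $i$ (distinct arms have distinct indices). Priorities are compared lexicographically, from the first to the third component, the larger value having higher priority; $\succ$ denotes the resulting strict order. Rules. For $\mathcal{A}\subseteq\mathcal{N}_t^{\mathrm{act}}$ put $\bar\psi(\mathcal{A})=\bigcup_{j\in\mathcal{A}}(\psi_{j,t}\cup\chi_{j,t})$ and $\bar\chi(\mathcal{A})=\bigcup_{j\in\mathcal{A}}\chi_{j,t}$, and define $$T_{\xi}(\mathcal{A})=\mathcal{A}\setminus\{i\in\mathcal{A}\mid \exists r\in\xi_{i,t},\ \exists j\in\mathcal{A}\setminus\{i\}:\ r\in\xi_{j,t}\ \wedge\ \rho(a_{j,t})\succ\rho(a_{i,t})\},$$ $$T_{\zeta}(\mathcal{A})=\mathcal{A}\setminus\{i\in\mathcal{A}\mid \zeta_{i,t}=G\neq\varnothing\ \wedge\ \neg(\forall m\in G:\ m\in\mathcal{A}\wedge\zeta_{m,t}=G)\},$$ $$T_{\alpha}(\mathcal{A})=\mathcal{A}\setminus\{i\in\mathcal{A}\mid \alpha_{i,t}\not\subseteq\bar\psi(\mathcal{A})\cup W_t\},$$ $$T_{\omega}(\mathcal{A})=\mathcal{A}\setminus\{i\in\mathcal{A}\mid \omega_{i,t}\not\subseteq\bar\chi(\mathcal{A})\cup W_t\}.$$ The executable set at step $t$ is by definition the result of applying $\Theta=T_{\xi}\circ T_{\zeta}\circ T_{\alpha}\circ T_{\omega}$ repeatedly, starting from $\mathcal{N}_t^{\mathrm{act}}$, until the result no longer changes. *)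

theory Defs
  imports Main "HOL-Library.Product_Lexorder"
begin

datatype ('e, 'p) action = Stay | Place 'e 'p

text \<open>
  Arms are natural numbers and time slots are indexed by \<^typ>\<open>nat\<close>. The first group of fields is fixed
  over time; the remaining fields take a time slot, and all but the last of them also an arm.
  Elements to be occupied exclusively live in \<^typ>\<open>'e + 'p\<close>, the disjoint union of objects and
  resources.
\<close>
record ('e, 'p, 'x) arm_system =
  num_arms :: nat
  objects :: "'e set"
  resources :: "'p set"
  conditions :: "'x set"
  pos :: "'p \<Rightarrow> int"
  target :: "'e \<Rightarrow> 'p"
  index :: "nat \<Rightarrow> nat"
  act :: "nat \<Rightarrow> nat \<Rightarrow> ('e, 'p) action"
  xi :: "nat \<Rightarrow> nat \<Rightarrow> ('e + 'p) set"
  zeta :: "nat \<Rightarrow> nat \<Rightarrow> nat set"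
  alpha :: "nat \<Rightarrow> nat \<Rightarrow> 'x set"
  omega :: "nat \<Rightarrow> nat \<Rightarrow> 'x set"
  psi :: "nat \<Rightarrow> nat \<Rightarrow> 'x set"
  chi :: "nat \<Rightarrow> nat \<Rightarrow> 'x set"
  true_conds :: "nat \<Rightarrow> 'x set"

definition arms :: "('e, 'p, 'x) arm_system \<Rightarrow> nat set" where
  "arms S = {1..num_arms S}"

definition acting :: "('e, 'p, 'x) arm_system \<Rightarrow> nat \<Rightarrow> nat set" where
  "acting S t = {i \<in> arms S. act S t i \<noteq> Stay}"

definition valid_system :: "('e, 'p, 'x) arm_system \<Rightarrow> bool" where
  "valid_system S \<longleftrightarrow>
     finite (objects S) \<and> finite (resources S) \<and>
     (\<forall>e \<in> objects S. target S e \<in> resources S) \<and>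
     inj_on (index S) (arms S)"

definition valid_slot :: "('e, 'p, 'x) arm_system \<Rightarrow> nat \<Rightarrow> bool" where
  "valid_slot S t \<longleftrightarrow>
     (\<forall>i \<in> arms S. act S t i \<in> {Stay} \<union> {Place e p | e p. e \<in> objects S \<and> p \<in> resources S}) \<and>
     (\<forall>i \<in> acting S t.
        xi S t i \<subseteq> objects S <+> resources S \<and>
        zeta S t i \<subseteq> arms S \<and>
        alpha S t i \<subseteq> conditions S \<and>
        omega S t i \<subseteq> conditions S \<and>
        psi S t i \<subseteq> conditions S \<and>
        chi S t i \<subseteq> conditions S) \<and>
     true_conds S t \<subseteq> conditions S"

text \<open>
  The order on the triples below is the lexicographic one of \<^theory>\<open>HOL-Library.Product_Lexorder\<close>;
  a larger triple means higher priority. Only acting arms have a priority.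
\<close>
definition priority :: "('e, 'p, 'x) arm_system \<Rightarrow> nat \<Rightarrow> nat \<Rightarrow> int \<times> int \<times> int" where
  "priority S t i =
     (case act S t i of
        Place e p \<Rightarrow>
          (if p = target S e then 1 else 0,
           - \<bar>pos S p - pos S (target S e)\<bar>,
           - int (index S i))
      | Stay \<Rightarrow> undefined)"

definition psi_bar :: "('e, 'p, 'x) arm_system \<Rightarrow> nat \<Rightarrow> nat set \<Rightarrow> 'x set" where
  "psi_bar S t A = (\<Union>j \<in> A. psi S t j \<union> chi S t j)"

definition chi_bar :: "('e, 'p, 'x) arm_system \<Rightarrow> nat \<Rightarrow> nat set \<Rightarrow> 'x set" where
  "chi_bar S t A = (\<Union>j \<in> A. chi S t j)"

definition T_xi :: "('e, 'p, 'x) arm_system \<Rightarrow> nat \<Rightarrow> nat set \<Rightarrow> nat set" where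
  "T_xi S t A =
     A - {i \<in> A. \<exists>r \<in> xi S t i. \<exists>j \<in> A - {i}. r \<in> xi S t j \<and> priority S t j > priority S t i}"

definition T_zeta :: "('e, 'p, 'x) arm_system \<Rightarrow> nat \<Rightarrow> nat set \<Rightarrow> nat set" where
  "T_zeta S t A =
     A - {i \<in> A. zeta S t i \<noteq> {} \<and> \<not> (\<forall>m \<in> zeta S t i. m \<in> A \<and> zeta S t m = zeta S t i)}"

definition T_alpha :: "('e, 'p, 'x) arm_system \<Rightarrow> nat \<Rightarrow> nat set \<Rightarrow> nat set" where
  "T_alpha S t A = A - {i \<in> A. \<not> alpha S t i \<subseteq> psi_bar S t A \<union> true_conds S t}"

definition T_omega :: "('e, 'p, 'x) arm_system \<Rightarrow> nat \<Rightarrow> nat set \<Rightarrow> nat set" where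
  "T_omega S t A = A - {i \<in> A. \<not> omega S t i \<subseteq> chi_bar S t A \<union> true_conds S t}"

definition Theta :: "('e, 'p, 'x) arm_system \<Rightarrow> nat \<Rightarrow> nat set \<Rightarrow> nat set" where
  "Theta S t = T_xi S t \<circ> T_zeta S t \<circ> T_alpha S t \<circ> T_omega S t"

end

theory Submission
  imports Defs
begin

text \<open>Each of the four rules only deletes arms, so \<open>Theta\<close> is deflationary
  (\<open>Theta_subset\<close>). The iterates therefore form a descending chain of finite sets:
  every round either loses at least one arm or has reached a fixed point, where the chain stays. At
  most \<open>card (acting S t)\<close> rounds can lose an arm
  (\<open>deflationary_funpow_stable\<close>). Counting takes the place of a monotone fixpoint
  argument, since \<open>T_xi\<close> is not monotone in general: adding a stronger rival can remove
  an arm.\<close>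

lemma funpow_fixpoint:
  assumes "f x = x"
  shows "(f ^^ n) x = x"
  using assms by (induction n) auto

text \<open>Induction on the bound \<open>n\<close>, for all \<open>A\<close> at once: if
  \<open>A\<close> is not yet fixed, \<open>f A\<close> is strictly smaller, so the bound
  \<open>n\<close> suffices from there, and \<open>f\<close> still shrinks all subsets of
  \<open>f A\<close>. For \<open>n = 0\<close> the set is empty, hence fixed.\<close>

lemma deflationary_funpow_stable:
  assumes "finite A" and "\<And>B. B \<subseteq> A \<Longrightarrow> f B \<subseteq> B" and "card A \<le> n"
  shows "f ((f ^^ n) A) = (f ^^ n) A"
  using assms
proof (induction n arbitrary: A)
  case 0
  then show ?case by auto
next
  case (Suc n)
  show ?case
  proof (cases "f A = A")
    case True
    then show ?thesis by (metis funpow_fixpoint)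
  next
    case False
    with Suc.prems(2) have sub: "f A \<subset> A" by blast
    with Suc.prems(3) have "card (f A) \<le> n"
      using psubset_card_mono[OF Suc.prems(1) sub] by linarith
    moreover have "finite (f A)"
      using sub Suc.prems(1) finite_subset by blast
    ultimately have "f ((f ^^ n) (f A)) = (f ^^ n) (f A)"
      using sub Suc.prems(2) by (intro Suc.IH) auto
    \<comment> \<open>The first round is split off on the inside, so that \<open>n\<close> rounds
      starting from \<open>f A\<close> remain.\<close>
    then show ?thesis by (simp only: funpow_Suc_right comp_apply)
  qed
qed

lemma Theta_subset: "Theta S t A \<subseteq> A"
  by (auto simp: Theta_def T_xi_def T_zeta_def T_alpha_def T_omega_def)

lemma finite_acting: "finite (acting S t)"
  by (simp add: acting_def arms_def)

theorem proposition1: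
  fixes S :: "('e, 'p, 'x) arm_system" and t :: nat
  assumes "valid_system S" and "valid_slot S t"
  shows "(\<forall>A \<subseteq> acting S t. Theta S t A \<subseteq> A) \<and>
    (\<exists>Astar.
       (\<exists>K. \<forall>k \<ge> K. (Theta S t ^^ k) (acting S t) = Astar) \<and>
       (\<forall>B. (\<exists>K. \<forall>k \<ge> K. (Theta S t ^^ k) (acting S t) = B) \<longrightarrow> B = Astar) \<and>
       Theta S t Astar = Astar \<and>
       (\<forall>k \<ge> card (acting S t). (Theta S t ^^ k) (acting S t) = Astar))"
proof -
  let ?it = "\<lambda>k. (Theta S t ^^ k) (acting S t)"
  let ?N = "card (acting S t)"
  have fixp: "Theta S t (?it ?N) = ?it ?N"
    by (intro deflationary_funpow_stable finite_acting Theta_subset order_refl)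
  have stable: "?it k = ?it ?N" if "k \<ge> ?N" for k
  proof -
    \<comment> \<open>The \<open>k - ?N\<close> rounds after round \<open>?N\<close> act on a fixed
      point.\<close>
    have "?it k = (Theta S t ^^ (k - ?N)) (?it ?N)"
      using that funpow_add[of "k - ?N" ?N "Theta S t"] by simp
    also have "\<dots> = ?it ?N"
      by (rule funpow_fixpoint[of "Theta S t", OF fixp])
    finally show ?thesis .
  qed
  have unique: "B = ?it ?N" if "\<forall>k \<ge> K. ?it k = B" for B K
    \<comment> \<open>Both eventual values are read off at the common round
      \<open>max K ?N\<close>.\<close>
    using that[rule_format, OF max.cobounded1] stable[OF max.cobounded2] by (rule trans[OF sym])
  show ?thesis
  proof (intro conjI exI[of _ "?it ?N"])
    show "\<forall>A \<subseteq> acting S t. Theta S t A \<subseteq> A"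
      by (simp add: Theta_subset)
    show "\<exists>K. \<forall>k \<ge> K. ?it k = ?it ?N"
      by (intro exI allI impI) (rule stable)
    show "\<forall>B. (\<exists>K. \<forall>k \<ge> K. ?it k = B) \<longrightarrow> B = ?it ?N"
      by (intro allI impI) (elim exE, rule unique)
    show "Theta S t (?it ?N) = ?it ?N"
      by (rule fixp)
    show "\<forall>k \<ge> ?N. ?it k = ?it ?N"
      by (intro allI impI) (rule stable)
  qed
qed

end
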